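(* Let $d$ be an odd positive integer and let $\mathbf r=(r_1,\dots,r_d)$ be a vector of integers with $r_i\ge 7$ for all $i$. Then $$\psi\big(M^{(d)}_{\mathbf r}(K_2)\big)=\left\lceil\frac d2\right\rceil+2.$$
   Context: For a positive integer $r$ let $P$ be the path on vertices $0,1,\dots,r$ (edges $\{i-1,i\}$) with an additional loop at vertex $0$. The generalized Mycielskian $M_r(G)$ of a graph $G$ is obtained from the direct product $P\times G$ (vertex set $V(P)\times V(G)$, with $(a,u)$ adjacent to $(a',u')$ iff $\{a,a'\}\in E(P)$ (the loop allowing $a=a'=0$) and $\{u,u'\}\in E(G)$) by identifying all vertices whose first coordinate is $r$ into a single vertex. For $\mathbf r=(r_1,\dots,r_d)$, $M^{(d)}_{\mathbf r}(G)=M_{r_d}(M_{r_{d-1}}(\cdots M_{r_1}(G)\cdots))$. $K_2$ is the complete graph on two vertices. The local chromatic number is $\psi(G)=\min_c\max_{v\in V(G)}|\{c(u):u\in N(v)\}|+1$, minimum over all proper colorings $c$ of $G$, where $N(v)$ is the neighbourhood of $v$. *)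

theory Defs
  imports Complex_Main "Graph_Theory.Graph_Theory"
begin

text \<open>Undirected graphs, possibly with loops, are pair digraphs with a symmetric arc relation.\<close>

definition looped_path :: "nat \<Rightarrow> nat pair_pre_digraph" where
  "looped_path r =
    \<lparr> pverts = {0..r},
      parcs = {(0, 0)} \<union> (\<Union>i\<in>{1..r}. {(i - 1, i), (i, i - 1)}) \<rparr>"

definition direct_product ::
  "'a pair_pre_digraph \<Rightarrow> 'b pair_pre_digraph \<Rightarrow> ('a \<times> 'b) pair_pre_digraph" where
  "direct_product G H =
    \<lparr> pverts = pverts G \<times> pverts H,
      parcs = {((a, u), (a', u')). (a, a') \<in> parcs G \<and> (u, u') \<in> parcs H} \<rparr>"

text \<open>The image graph: vertices with the same image under the map are identified.\<close>

definition image_graph :: "('a \<Rightarrow> 'b) \<Rightarrow> 'a pair_pre_digraph \<Rightarrow> 'b pair_pre_digraph" where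
  "image_graph f G = \<lparr> pverts = f ` pverts G, parcs = map_prod f f ` parcs G \<rparr>"

text \<open>
  The Mycielskian changes the vertex set, so that iterating it requires a type closed under the
  construction: \<open>Level a u\<close> is the vertex \<open>(a, u)\<close> of the product, \<open>Apex\<close> is the single vertex
  obtained from the top level, and \<open>Base\<close> embeds the vertices of the initial graph.
\<close>

datatype 'a mvertex = Base 'a | Level nat "'a mvertex" | Apex

definition gen_mycielskian ::
  "nat \<Rightarrow> 'a mvertex pair_pre_digraph \<Rightarrow> 'a mvertex pair_pre_digraph" where
  "gen_mycielskian r G =
    image_graph (\<lambda>(a, u). if a = r then Apex else Level a u) (direct_product (looped_path r) G)"

text \<open>The head of the list is the parameter of the innermost Mycielskian.\<close>

definition iterated_mycielskian ::
  "nat list \<Rightarrow> 'a pair_pre_digraph \<Rightarrow> 'a mvertex pair_pre_digraph" where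
  "iterated_mycielskian rs G = fold gen_mycielskian rs (image_graph Base G)"

definition neighbourhood :: "'a pair_pre_digraph \<Rightarrow> 'a \<Rightarrow> 'a set" where
  "neighbourhood G v = {u \<in> pverts G. (v, u) \<in> parcs G}"

definition proper_coloring :: "'a pair_pre_digraph \<Rightarrow> ('a \<Rightarrow> 'c) \<Rightarrow> bool" where
  "proper_coloring G c \<longleftrightarrow> (\<forall>(u, v)\<in>parcs G. c u \<noteq> c v)"

text \<open>
  Meant for finite nonempty loopless graphs: there natural numbers suffice as colors, a proper
  coloring exists, and hence the infimum of natural numbers is an attained minimum.
\<close>

definition local_chromatic_number :: "'a pair_pre_digraph \<Rightarrow> nat" where
  "local_chromatic_number G =
    (INF c\<in>{c :: 'a \<Rightarrow> nat. proper_coloring G c}.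
      MAX v\<in>pverts G. card (c ` neighbourhood G v)) + 1"

end

theory Submission
  imports Defs "HOL-Library.Z2" "HOL-Library.Multiset"
begin

text \<open>
  Lower bound: a signed vertex is a vertex on one of the two sides of the box complex, and the
  box complex of \<open>M\<^sub>r(G)\<close> contains a suspension of that of \<open>G\<close>, because the two sides can be
  pushed up the levels alternately until the apex cones them off. Hence iterating the construction
  on \<open>K\<^sub>2\<close> gives a symmetric mod 2 sphere of dimension \<open>d + 1\<close>. As in Ky Fan's theorem, for every
  coloring its hemisphere has an odd number of simplices whose signs alternate when the \<open>d + 2\<close>
  vertices are sorted by color. Such a simplex is a complete bipartite graph with distinct colors,
  so a vertex on its smaller side sees \<open>(d + 3) / 2\<close> colors.

  Upper bound (Simonyi and Tardos): call a coloring wide if the ends of every walk of length 5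
  differ. For \<open>r \<ge> 7\<close> a wide coloring of \<open>G\<close> extends to \<open>M\<^sub>r(G)\<close> with one more color. Given a wide
  coloring with \<open>t\<close> colors, recoloring the neighbours of all vertices that see more than \<open>t / 2\<close>
  colors by one new color leaves at most \<open>t / 2 + 1\<close> colors in every neighbourhood.
\<close>

section \<open>Ordered chains modulo 2\<close>

lemma bit_add_self [simp]: "x + x = 0" for x :: bit
  by (cases x) simp_all

lemma bit_add_left_self [simp]: "x + (x + y) = y" for x y :: bit
  by (cases x; cases y) simp_all

(* This rule turns sums into bitwise XOR, where the laws of \<open>sum_list\<close> do not apply. *)
declare add_bit_eq_xor [simp del]

lemma sum_list_concat_map [simp]:
  "(\<Sum>x\<leftarrow>concat (map f xs). F x) = (\<Sum>x\<leftarrow>xs. \<Sum>y\<leftarrow>f x. F y)"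
  by (induction xs) simp_all

lemma sum_list_map_map [simp]: "(\<Sum>x\<leftarrow>map f xs. F x) = (\<Sum>x\<leftarrow>xs. F (f x))"
  by (simp add: o_def)

primrec faces :: "'a list \<Rightarrow> 'a list list" where
  "faces [] = []"
| "faces (a # s) = s # map ((#) a) (faces s)"

lemma faces_map: "faces (map f s) = map (map f) (faces s)"
  by (induction s) simp_all

lemma set_faces: "t \<in> set (faces s) \<Longrightarrow> set t \<subseteq> set s"
  by (induction s arbitrary: t) fastforce+

text \<open>The standard triangulation of simplex times interval, with \<open>f\<close> on the
  bottom and \<open>g\<close> on the top.\<close>

primrec prism :: "('a \<Rightarrow> 'b) \<Rightarrow> ('a \<Rightarrow> 'b) \<Rightarrow> 'a list \<Rightarrow> 'b list list" where
  "prism f g [] = []"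
| "prism f g (a # s) = (f a # g a # map g s) # map ((#) (f a)) (prism f g s)"

lemma length_prism: "t \<in> set (prism f g s) \<Longrightarrow> length t = Suc (length s)"
  by (induction s arbitrary: t) auto

lemma set_prism: "t \<in> set (prism f g s) \<Longrightarrow> set t \<subseteq> f ` set s \<union> g ` set s"
  by (induction s arbitrary: t) fastforce+

text \<open>The chain homotopy identity of the prism operator, without signs modulo 2. A general
  cochain \<open>F\<close> lets the induction pass to
  \<open>\<lambda>u. F (f a # u)\<close>.\<close>

lemma prism_homotopy:
  fixes F :: "'b list \<Rightarrow> bit"
  shows "(\<Sum>t\<leftarrow>prism f g s. \<Sum>u\<leftarrow>faces t. F u) + (\<Sum>t\<leftarrow>faces s. \<Sum>u\<leftarrow>prism f g t. F u)
    = F (map f s) + F (map g s)"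
proof (induction s arbitrary: F)
  case Nil
  show ?case by simp
next
  case (Cons a s)
  show ?case
    using Cons[of "\<lambda>u. F (f a # u)"]
    by (simp add: sum_list_addf faces_map o_def ac_simps)
qed

text \<open>
  A list of simplices stands for its sum modulo 2, and chains are compared by evaluating cochains
  \<open>F\<close> on them. Faces include the empty one, so this is reduced homology.
\<close>

definition cycle :: "'a list list \<Rightarrow> bool" where
  "cycle z \<longleftrightarrow> (\<forall>F :: 'a list \<Rightarrow> bit. (\<Sum>s\<leftarrow>z. \<Sum>t\<leftarrow>faces s. F t) = 0)"

lemma prism_cycle:
  fixes F :: "'b list \<Rightarrow> bit"
  assumes "cycle z"
  shows "(\<Sum>s\<leftarrow>z. \<Sum>t\<leftarrow>prism f g s. \<Sum>u\<leftarrow>faces t. F u) = (\<Sum>s\<leftarrow>z. F (map f s)) + (\<Sum>s\<leftarrow>z. F (map g s))"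
proof -
  have "(\<Sum>s\<leftarrow>z. \<Sum>t\<leftarrow>prism f g s. \<Sum>u\<leftarrow>faces t. F u)
      + (\<Sum>s\<leftarrow>z. \<Sum>t\<leftarrow>faces s. \<Sum>u\<leftarrow>prism f g t. F u) = (\<Sum>s\<leftarrow>z. F (map f s) + F (map g s))"
    by (simp flip: sum_list_addf add: prism_homotopy)
  moreover have "(\<Sum>s\<leftarrow>z. \<Sum>t\<leftarrow>faces s. \<Sum>u\<leftarrow>prism f g t. F u) = 0"
    using assms unfolding cycle_def by blast
  ultimately show ?thesis by (simp add: sum_list_addf)
qed

text \<open>The faces through \<open>a\<close> form the cone over the boundary of the cycle, which
  vanishes; only the base remains.\<close>

lemma cone_cycle:
  fixes F :: "'a list \<Rightarrow> bit"
  assumes "cycle z"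
  shows "(\<Sum>s\<leftarrow>z. \<Sum>t\<leftarrow>faces (a # map f s). F t) = (\<Sum>s\<leftarrow>z. F (map f s))"
proof -
  have "(\<Sum>s\<leftarrow>z. \<Sum>t\<leftarrow>faces s. F (a # map f t)) = 0"
    using assms unfolding cycle_def by blast
  then show ?thesis by (simp add: sum_list_addf faces_map o_def)
qed

section \<open>Alternating sign words\<close>

text \<open>Prepending the opposite sign makes this true of the empty word.\<close>

definition alternating_from :: "bool \<Rightarrow> bool list \<Rightarrow> bool" where
  "alternating_from b p \<longleftrightarrow> distinct_adj ((\<not> b) # p)"

text \<open>The parity core of Fan's argument. In an alternating word only deleting an end leaves an
  alternating word, and exactly one such face alternates from \<open>b\<close>. Otherwise
  alternating faces come in equal pairs, from deleting either letter of the only repetition. The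
  induction splits off the first letter instead.\<close>

lemma alternating_faces:
  "p \<noteq> [] \<Longrightarrow> (\<Sum>q\<leftarrow>faces p. of_bool (alternating_from b q)) = (of_bool (distinct_adj p) :: bit)"
proof (induction p arbitrary: b)
  case Nil
  then show ?case by simp
next
  case (Cons x p)
  show ?case
  proof (cases p)
    case Nil
    then show ?thesis by (simp add: alternating_from_def)
  next
    case (Cons y l)
    \<comment> \<open>These faces keep \<open>x\<close>; behind it the alternation must start with
      the opposite sign, hence the induction hypothesis at \<open>\<not> b\<close>.\<close>
    have eq: "(\<Sum>q\<leftarrow>faces p. of_bool (alternating_from b (x # q)))
        = (if x = b then of_bool (distinct_adj p) else 0 :: bit)"
    proof (cases "x = b")
      case True
      then have "alternating_from b (x # q) = alternating_from (\<not> b) q" for q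
        by (auto simp: alternating_from_def)
      then show ?thesis using Cons.IH[of "\<not> b"] Cons True by simp
    next
      case False
      then show ?thesis by (simp add: alternating_from_def)
    qed
    have "alternating_from b p \<longleftrightarrow> y = b \<and> distinct_adj p"
      using Cons by (auto simp: alternating_from_def)
    then show ?thesis
      using Cons eq by (cases "x = b"; cases "y = b") (auto simp: o_def)
  qed
qed

lemma alternating_from_iff: "p \<noteq> [] \<Longrightarrow> alternating_from b p \<longleftrightarrow> hd p = b \<and> distinct_adj p"
  by (cases p) (auto simp: alternating_from_def distinct_adj_Cons)

text \<open>Negation swaps the two possible first signs of an alternating word, so exactly one of
  the two words counts.\<close>

lemma alternating_from_sum:
  "p \<noteq> [] \<Longrightarrow> of_bool (alternating_from b p) + of_bool (alternating_from b (map Not p))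
    = (of_bool (distinct_adj p) :: bit)"
  by (auto simp: alternating_from_iff distinct_adj_map_iff inj_on_def hd_map)

lemma distinct_adj_bool_nth:
  assumes "distinct_adj p" "i < length p"
  shows "p ! i = (even i = p ! 0)"
  using assms(2)
proof (induction i)
  case (Suc i)
  then have "p ! i \<noteq> p ! Suc i"
    using assms(1) by (simp add: distinct_adj_def successively_conv_nth)
  then show ?case using Suc by auto
qed simp

text \<open>Deleting \<open>a\<close> undoes the insertion, and deleting another entry commutes with
  it. Multisets absorb the changed order of the faces.\<close>

lemma faces_insort_key:
  assumes "sorted (map f l)"
  shows "mset (faces (insort_key f a l)) = mset (l # map (insort_key f a) (faces l))"
  using assms
proof (induction l)
  case Nil
  then show ?case by simp
next
  case (Cons b l)
  show ?case
  proof (cases "f a \<le> f b")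
    case True
    have "insort_key f a q = a # q" if "q \<in> set (faces (b # l))" for q
      using set_faces[OF that] True Cons.prems by (cases q) fastforce+
    then have "map (insort_key f a) (faces (b # l)) = map ((#) a) (faces (b # l))"
      by (intro map_cong) auto
    moreover have "insort_key f a (b # l) = a # b # l" using True by simp
    ultimately show ?thesis by (simp only: faces.simps)
  next
    case False
    have *: "image_mset ((#) b) (mset (faces (insort_key f a l)))
        = image_mset ((#) b) (mset (l # map (insort_key f a) (faces l)))"
      using Cons by simp
    show ?thesis using False * by (simp add: image_mset.compositionality o_def)
  qed
qed

lemma faces_sort_key: "mset (map (sort_key f) (faces s)) = mset (faces (sort_key f s))"
proof (induction s)
  case Nil
  then show ?case by simp
next
  case (Cons a s)
  have *: "image_mset (insort_key f a) (mset (map (sort_key f) (faces s)))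
      = image_mset (insort_key f a) (mset (faces (sort_key f s)))"
    using Cons by simp
  then show ?case
    using faces_insort_key[of f "sort_key f s" a] by (simp add: image_mset.compositionality o_def)
qed

text \<open>The sorting key ignores the signs, so that flipping all signs commutes with sorting.\<close>

definition sign_word :: "('v \<Rightarrow> nat) \<Rightarrow> ('v \<times> bool) list \<Rightarrow> bool list" where
  "sign_word c s = map snd (sort_key (c \<circ> fst) s)"

lemma length_sign_word [simp]: "length (sign_word c s) = length s"
  by (simp add: sign_word_def)

lemma sign_word_eq_Nil_iff [simp]: "sign_word c s = [] \<longleftrightarrow> s = []"
  by (metis length_0_conv length_sign_word)

lemma sort_key_map: "sort_key f (map g s) = map g (sort_key (f \<circ> g) s)"
proof -
  have "insort_key f (g a) (map g s) = map g (insort_key (f \<circ> g) a s)" for a s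
    by (induction s) auto
  then show ?thesis by (induction s) auto
qed

lemma sign_word_map_prod: "sign_word c (map (map_prod f g) s) = map g (sign_word (c \<circ> f) s)"
proof -
  have "(c \<circ> fst) \<circ> map_prod f g = (c \<circ> f) \<circ> fst" by auto
  then show ?thesis by (simp add: sign_word_def sort_key_map)
qed

lemma sign_word_faces:
  "mset (map (sign_word c) (faces s)) = mset (faces (sign_word c s))"
proof -
  have "mset (map (sign_word c) (faces s))
      = image_mset (map snd) (mset (map (sort_key (c \<circ> fst)) (faces s)))"
    unfolding mset_map image_mset.compositionality
    by (intro arg_cong2[where f = image_mset]) (auto simp: sign_word_def)
  also have "\<dots> = mset (faces (sign_word c s))"
    unfolding faces_sort_key by (simp add: sign_word_def faces_map)
  finally show ?thesis .
qed

text \<open>Carries \<open>alternating_faces\<close> over to simplices, so that the alternating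
  simplices of a chain can be counted on its boundary.\<close>

lemma sum_alternating_faces:
  assumes "s \<noteq> []"
  shows "(\<Sum>t\<leftarrow>faces s. of_bool (alternating_from b (sign_word c t)))
    = (of_bool (distinct_adj (sign_word c s)) :: bit)"
proof -
  let ?F = "\<lambda>q. of_bool (alternating_from b q) :: bit"
  have "(\<Sum>t\<leftarrow>faces s. ?F (sign_word c t)) = sum_mset (image_mset ?F (mset (map (sign_word c) (faces s))))"
    by (simp add: image_mset.compositionality o_def flip: sum_mset_sum_list)
  also have "\<dots> = (\<Sum>q\<leftarrow>faces (sign_word c s). ?F q)"
    unfolding sign_word_faces by (simp flip: sum_mset_sum_list)
  also have "\<dots> = of_bool (distinct_adj (sign_word c s))"
    using assms by (simp add: alternating_faces)
  finally show ?thesis .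
qed

section \<open>Generalized Mycielskians\<close>

definition node :: "nat \<Rightarrow> nat \<Rightarrow> 'a mvertex \<Rightarrow> 'a mvertex" where
  "node r a u = (if a = r then Apex else Level a u)"

lemma looped_path_arc:
  "(a, b) \<in> parcs (looped_path r) \<longleftrightarrow> a = 0 \<and> b = 0 \<or> b = Suc a \<and> b \<le> r \<or> a = Suc b \<and> a \<le> r"
  by (auto simp: looped_path_def Bex_def)

lemma parcs_gen_mycielskian:
  "parcs (gen_mycielskian r H)
    = {(node r a u, node r b v) | a b u v. (a, b) \<in> parcs (looped_path r) \<and> (u, v) \<in> parcs H}"
  by (force simp: gen_mycielskian_def image_graph_def direct_product_def node_def image_iff)

lemma gen_mycielskian_arcI:
  "(a, b) \<in> parcs (looped_path r) \<Longrightarrow> (u, v) \<in> parcs H \<Longrightarrow>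
    (node r a u, node r b v) \<in> parcs (gen_mycielskian r H)"
  unfolding parcs_gen_mycielskian by blast

lemma gen_mycielskian_arcE:
  assumes "(x, y) \<in> parcs (gen_mycielskian r H)"
  obtains a b u v where "(a, b) \<in> parcs (looped_path r)" "(u, v) \<in> parcs H"
    "x = node r a u" "y = node r b v"
  using assms unfolding parcs_gen_mycielskian by blast

lemma pverts_gen_mycielskian:
  "pverts (gen_mycielskian r H) = {node r a u | a u. a \<le> r \<and> u \<in> pverts H}"
  by (fastforce simp: gen_mycielskian_def image_graph_def direct_product_def node_def
      looped_path_def image_iff)

text \<open>An invariant of the iteration; finiteness and nonemptiness make the maxima in
  \<open>local_chromatic_number\<close> meaningful.\<close>

definition finite_graph :: "'v pair_pre_digraph \<Rightarrow> bool" where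
  "finite_graph H \<longleftrightarrow>
    finite (pverts H) \<and> pverts H \<noteq> {} \<and> parcs H \<subseteq> pverts H \<times> pverts H \<and> sym (parcs H)"

lemma finite_graph_gen_mycielskian:
  assumes "finite_graph H"
  shows "finite_graph (gen_mycielskian r H)"
proof -
  have "pverts (gen_mycielskian r H) = (\<lambda>(a, u). node r a u) ` ({..r} \<times> pverts H)"
    by (auto simp: pverts_gen_mycielskian)
  then have "finite (pverts (gen_mycielskian r H))" "pverts (gen_mycielskian r H) \<noteq> {}"
    using assms by (auto simp: finite_graph_def)
  moreover have "sym (parcs (gen_mycielskian r H))"
  proof (rule symI, elim gen_mycielskian_arcE)
    fix x y a b u v
    assume "(a, b) \<in> parcs (looped_path r)" "(u, v) \<in> parcs H" "x = node r a u" "y = node r b v"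
    moreover from this have "(b, a) \<in> parcs (looped_path r)" by (auto simp: looped_path_arc)
    moreover have "(v, u) \<in> parcs H"
      using assms \<open>(u, v) \<in> parcs H\<close> by (auto simp: finite_graph_def dest: symD)
    ultimately show "(y, x) \<in> parcs (gen_mycielskian r H)" by (simp add: gen_mycielskian_arcI)
  qed
  moreover have "x \<in> pverts (gen_mycielskian r H) \<and> y \<in> pverts (gen_mycielskian r H)"
    if "(x, y) \<in> parcs (gen_mycielskian r H)" for x y
    using that
  proof (elim gen_mycielskian_arcE)
    fix a b u v
    assume "(a, b) \<in> parcs (looped_path r)" "(u, v) \<in> parcs H" "x = node r a u" "y = node r b v"
    moreover from this have "a \<le> r" "b \<le> r" by (auto simp: looped_path_arc)
    moreover have "u \<in> pverts H" "v \<in> pverts H"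
      using assms \<open>(u, v) \<in> parcs H\<close> by (auto simp: finite_graph_def)
    ultimately show ?thesis by (auto simp: pverts_gen_mycielskian)
  qed
  then have "parcs (gen_mycielskian r H) \<subseteq> pverts (gen_mycielskian r H) \<times> pverts (gen_mycielskian r H)"
    by auto
  ultimately show ?thesis by (simp add: finite_graph_def)
qed

section \<open>The lower bound\<close>

text \<open>A one-sided simplex needs no common neighbour, only vertices that are not isolated: the
  two ends of an edge may form one side, as in \<open>fan_chain_edge\<close>.\<close>

definition box_simplex :: "'v pair_pre_digraph \<Rightarrow> ('v \<times> bool) set \<Rightarrow> bool" where
  "box_simplex H S \<longleftrightarrow> (\<forall>(u, \<sigma>)\<in>S. \<exists>w. (u, w) \<in> parcs H) \<and>
    (\<forall>(u, \<sigma>)\<in>S. \<forall>(v, \<tau>)\<in>S. \<sigma> \<noteq> \<tau> \<longrightarrow> (u, v) \<in> parcs H)"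

lemma box_simplex_mono: "box_simplex H S \<Longrightarrow> T \<subseteq> S \<Longrightarrow> box_simplex H T"
  unfolding box_simplex_def by blast

lemma box_simplexD:
  "box_simplex H S \<Longrightarrow> p \<in> S \<Longrightarrow> q \<in> S \<Longrightarrow> snd p \<noteq> snd q \<Longrightarrow> (fst p, fst q) \<in> parcs H"
  by (cases p; cases q) (auto simp: box_simplex_def)

lemma box_simplex_insert:
  assumes "box_simplex H S" "\<exists>w. (u, w) \<in> parcs H"
    and "\<And>v. (v, \<not> \<sigma>) \<in> S \<Longrightarrow> (u, v) \<in> parcs H \<and> (v, u) \<in> parcs H"
  shows "box_simplex H (insert (u, \<sigma>) S)"
  using assms by (cases \<sigma>) (auto simp: box_simplex_def)

abbreviation flip :: "'v \<times> bool \<Rightarrow> 'v \<times> bool" where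
  "flip \<equiv> map_prod id Not"

lemma box_simplex_flip: "box_simplex H S \<Longrightarrow> box_simplex H (flip ` S)"
  unfolding box_simplex_def by fastforce

definition symmetrize :: "('v \<times> bool) list list \<Rightarrow> ('v \<times> bool) list list" where
  "symmetrize x = x @ map (map flip) x"

lemma sum_symmetrize:
  "(\<Sum>s\<leftarrow>symmetrize x. F s) = (\<Sum>s\<leftarrow>x. F s) + (\<Sum>s\<leftarrow>x. F (map flip s))"
  by (simp add: symmetrize_def o_def)

text \<open>
  A hemisphere of a symmetric sphere in the box complex (faces with one side empty included) on
  which every coloring has an odd number of alternating simplices.
\<close>

definition fan_chain :: "'v pair_pre_digraph \<Rightarrow> nat \<Rightarrow> ('v \<times> bool) list list \<Rightarrow> bool" where
  "fan_chain H n x \<longleftrightarrow> (\<forall>s\<in>set x. length s = n \<and> box_simplex H (set s)) \<and> cycle (symmetrize x) \<and>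
    (\<forall>c :: 'v \<Rightarrow> nat. (\<Sum>s\<leftarrow>x. of_bool (distinct_adj (sign_word c s))) = (1 :: bit))"

text \<open>Consecutive entries of a color-sorted alternating simplex are adjacent, so its colors
  increase strictly. The \<open>m + 1\<close> entries in even positions are neighbours of any entry
  in an odd one.\<close>

lemma local_colors_lower_bound:
  fixes c :: "'v \<Rightarrow> nat"
  assumes H: "finite_graph H" and x: "fan_chain H (2 * m + 1) x" and "m \<ge> 1" and c: "proper_coloring H c"
  shows "\<exists>v\<in>pverts H. card (c ` neighbourhood H v) \<ge> m + 1"
proof -
  have "\<exists>s\<in>set x. distinct_adj (sign_word c s)"
  proof (rule ccontr)
    assume "\<not> ?thesis"
    then have "(\<Sum>s\<leftarrow>x. of_bool (distinct_adj (sign_word c s))) = (\<Sum>s\<leftarrow>x. 0 :: bit)"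
      by (intro arg_cong[where f = sum_list] map_cong) auto
    then show False using x unfolding fan_chain_def by (metis sum_list_0 zero_neq_one)
  qed
  then obtain s where s: "s \<in> set x" "distinct_adj (sign_word c s)" by blast
  define l where "l = sort_key (c \<circ> fst) s"
  have len: "length l = 2 * m + 1" using x s(1) by (simp add: fan_chain_def l_def)
  have box: "box_simplex H (set l)" using x s(1) by (simp add: fan_chain_def l_def)
  have srt: "sorted (map (c \<circ> fst) l)" by (simp add: l_def)
  have alt: "snd (l ! i) = (even i = snd (l ! 0))" if "i < length l" for i
    using distinct_adj_bool_nth[OF s(2)[unfolded sign_word_def, folded l_def], of i] that len
    by simp
  have adj: "(fst (l ! i), fst (l ! j)) \<in> parcs H" if "i < length l" "j < length l" "odd (i + j)" for i j
  proof -
    have "snd (l ! i) \<noteq> snd (l ! j)" using alt[OF that(1)] alt[OF that(2)] that(3) by auto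
    moreover have "l ! i \<in> set l" "l ! j \<in> set l" using that by auto
    ultimately show ?thesis using box by (intro box_simplexD)
  qed
  have less: "c (fst (l ! i)) < c (fst (l ! j))" if "i < j" "j < length l" for i j
  proof -
    have "c (fst (l ! i)) \<noteq> c (fst (l ! Suc i))"
      using c adj[of i "Suc i"] that unfolding proper_coloring_def by auto
    moreover have "c (fst (l ! i)) \<le> c (fst (l ! Suc i))" "c (fst (l ! Suc i)) \<le> c (fst (l ! j))"
      using sorted_nth_mono[OF srt, of i "Suc i"] sorted_nth_mono[OF srt, of "Suc i" j] that by auto
    ultimately show ?thesis by simp
  qed
  \<comment> \<open>Position 1 is odd and exists because \<open>m \<ge> 1\<close>.\<close>
  define v where "v = fst (l ! 1)"
  have verts: "u \<in> pverts H \<and> w \<in> pverts H" if "(u, w) \<in> parcs H" for u w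
    using H that by (auto simp: finite_graph_def)
  have N: "fst (l ! (2 * i)) \<in> neighbourhood H v" if "i \<in> {..m}" for i
    using adj[of 1 "2 * i"] that len \<open>m \<ge> 1\<close> verts unfolding v_def neighbourhood_def by auto
  have "inj_on (\<lambda>i. c (fst (l ! (2 * i)))) {..m}"
  proof (rule linorder_inj_onI)
    fix i j assume "i < j" "i \<in> {..m}" "j \<in> {..m}"
    then show "c (fst (l ! (2 * i))) \<noteq> c (fst (l ! (2 * j)))"
      using less[of "2 * i" "2 * j"] len by simp
  qed auto
  then have "m + 1 = card ((\<lambda>i. c (fst (l ! (2 * i)))) ` {..m})"
    by (simp add: card_image)
  also have "\<dots> \<le> card (c ` neighbourhood H v)"
    using N H by (intro card_mono) (auto simp: finite_graph_def neighbourhood_def)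
  finally have "m + 1 \<le> card (c ` neighbourhood H v)" .
  moreover have "v \<in> pverts H"
    using adj[of 1 0] verts len \<open>m \<ge> 1\<close> by (auto simp: v_def)
  ultimately show ?thesis by blast
qed

section \<open>Lifting the box complex through the levels\<close>

text \<open>
  Stage \<open>i\<close> of a homotopy that lifts the two sides of the box complex alternately, so that they
  always lie on adjacent levels.
\<close>

definition lift_level :: "nat \<Rightarrow> bool \<Rightarrow> nat" where
  "lift_level i \<sigma> = (if even i = \<sigma> then i else i - 1)"

definition lift :: "nat \<Rightarrow> 'a mvertex \<times> bool \<Rightarrow> 'a mvertex \<times> bool" where
  "lift i = (\<lambda>(v, \<sigma>). (Level (lift_level i \<sigma>) v, \<sigma>))"

lemma lift_0: "lift 0 = map_prod (Level 0) id"
  by (auto simp: lift_def lift_level_def)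

text \<open>From stage \<open>j - 1\<close> to stage \<open>j\<close> the side with sign
  \<open>even j\<close> moves from level \<open>j - 2\<close> to level \<open>j\<close>, while the
  other side rests on level \<open>j - 1\<close>, adjacent to both. For \<open>j = 1\<close> the
  move starts on level 0, where the loop supplies the adjacency.\<close>

lemma lift_level_upper:
  "i = j \<or> j = Suc i \<Longrightarrow> even j = \<sigma> \<Longrightarrow>
    lift_level i \<sigma> = j \<or> Suc (lift_level i \<sigma>) = j - 1 \<or> lift_level i \<sigma> = 0 \<and> j = 1"
  by (cases i) (auto simp: lift_level_def)

lemma lift_level_lower: "i = j \<or> j = Suc i \<Longrightarrow> even j \<noteq> \<sigma> \<Longrightarrow> lift_level i \<sigma> = j - 1"
  by (auto simp: lift_level_def)

lemma lift_level_arc: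
  assumes "j < r" "\<sigma> \<noteq> \<tau>" "i = j \<or> j = Suc i" "i' = j \<or> j = Suc i'"
  shows "(lift_level i \<sigma>, lift_level i' \<tau>) \<in> parcs (looped_path r)"
proof (cases "even j = \<sigma>")
  case True
  then have "lift_level i' \<tau> = j - 1" using assms by (simp add: lift_level_lower)
  with lift_level_upper[OF assms(3) True] show ?thesis
    unfolding looped_path_arc using \<open>j < r\<close> by linarith
next
  case False
  then have \<tau>: "even j = \<tau>" using assms(2) by blast
  have "lift_level i \<sigma> = j - 1" using False assms by (simp add: lift_level_lower)
  with lift_level_upper[OF assms(4) \<tau>] show ?thesis
    unfolding looped_path_arc using \<open>j < r\<close> by linarith
qed

lemma lift_adjacent:
  assumes "j < r" "(u, v) \<in> parcs H" "\<sigma> \<noteq> \<tau>" "i \<le> j" "i' \<le> j" "j \<le> Suc i" "j \<le> Suc i'"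
  shows "(Level (lift_level i \<sigma>) u, Level (lift_level i' \<tau>) v) \<in> parcs (gen_mycielskian r H)"
proof -
  let ?a = "lift_level i \<sigma>" and ?b = "lift_level i' \<tau>"
  have "i = j \<or> j = Suc i" "i' = j \<or> j = Suc i'" using assms by auto
  then have "(?a, ?b) \<in> parcs (looped_path r)" using assms(1,3) by (intro lift_level_arc)
  moreover have "?a < r" "?b < r" using assms by (auto simp: lift_level_def)
  then have "node r ?a u = Level ?a u" "node r ?b v = Level ?b v" by (simp_all add: node_def)
  ultimately show ?thesis using gen_mycielskian_arcI[OF _ assms(2)] by metis
qed

text \<open>The union contains every simplex of the prism between two consecutive stages. At
  \<open>j = 0\<close> truncated subtraction leaves the single stage 0.\<close>

lemma lift_simplex:
  assumes "box_simplex H S" "j < r"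
  shows "box_simplex (gen_mycielskian r H) (lift (j - 1) ` S \<union> lift j ` S)"
proof -
  have 1: "\<exists>w. (fst (lift i (u, \<sigma>)), w) \<in> parcs (gen_mycielskian r H)"
    if "(u, \<sigma>) \<in> S" "i = j - 1 \<or> i = j" for i u \<sigma>
  proof -
    obtain w where "(u, w) \<in> parcs H" using assms(1) \<open>(u, \<sigma>) \<in> S\<close> by (auto simp: box_simplex_def)
    moreover have "i \<le> j" "j \<le> Suc i" using that(2) by auto
    ultimately show ?thesis using lift_adjacent[of j r u w H \<sigma> "\<not> \<sigma>" i i] assms(2)
      by (auto simp: lift_def)
  qed
  have 2: "(fst (lift i (u, \<sigma>)), fst (lift i' (v, \<tau>))) \<in> parcs (gen_mycielskian r H)"
    if "(u, \<sigma>) \<in> S" "(v, \<tau>) \<in> S" "\<sigma> \<noteq> \<tau>" "i = j - 1 \<or> i = j" "i' = j - 1 \<or> i' = j" for i i' u v \<sigma> \<tau>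
  proof -
    have "(u, v) \<in> parcs H" using assms(1) that by (auto simp: box_simplex_def)
    moreover have "i \<le> j" "j \<le> Suc i" "i' \<le> j" "j \<le> Suc i'" using that(4,5) by auto
    ultimately show ?thesis using lift_adjacent[of j r u v H \<sigma> \<tau> i i'] that(3) assms(2)
      by (auto simp: lift_def)
  qed
  have 3: "\<exists>i u. (i = j - 1 \<or> i = j) \<and> (u, \<sigma>) \<in> S \<and> y = fst (lift i (u, \<sigma>))"
    if "(y, \<sigma>) \<in> lift (j - 1) ` S \<union> lift j ` S" for y \<sigma>
    using that by (auto simp: lift_def)
  show ?thesis
    unfolding box_simplex_def
  proof (intro conjI ballI; clarify)
    fix y \<sigma> assume "(y, \<sigma>) \<in> lift (j - 1) ` S \<union> lift j ` S"
    from 3[OF this] show "\<exists>w. (y, w) \<in> parcs (gen_mycielskian r H)" using 1 by blast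
  next
    fix y \<sigma> y' \<tau>
    assume "(y, \<sigma>) \<in> lift (j - 1) ` S \<union> lift j ` S" "(y', \<tau>) \<in> lift (j - 1) ` S \<union> lift j ` S" "\<sigma> \<noteq> \<tau>"
    from 3[OF this(1)] 3[OF this(2)] this(3)
    show "(y, y') \<in> parcs (gen_mycielskian r H)" using 2 by blast
  qed
qed

lemma apex_adjacent:
  assumes "r > 0" "(u, v) \<in> parcs H" "sym (parcs H)"
  shows "(Apex, Level (r - 1) u) \<in> parcs (gen_mycielskian r H)"
    and "(Level (r - 1) u, Apex) \<in> parcs (gen_mycielskian r H)"
proof -
  have "(r, r - 1) \<in> parcs (looped_path r)" "(r - 1, r) \<in> parcs (looped_path r)"
    using assms by (auto simp: looped_path_arc)
  moreover have "node r r v = Apex" "node r (r - 1) u = Level (r - 1) u"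
    using assms by (auto simp: node_def)
  moreover have "(v, u) \<in> parcs H" using assms by (auto dest: symD)
  ultimately show "(Apex, Level (r - 1) u) \<in> parcs (gen_mycielskian r H)"
    and "(Level (r - 1) u, Apex) \<in> parcs (gen_mycielskian r H)"
    using gen_mycielskian_arcI assms(2) by metis+
qed

text \<open>At stage \<open>r - 1\<close> the side with sign \<open>even (r - 1)\<close> is on level
  \<open>r - 1\<close>, next to the apex. The apex gets the opposite sign and so only has to be
  adjacent to that side.\<close>

lemma cone_simplex:
  assumes "box_simplex H S" "S \<noteq> {}" "r > 0" "sym (parcs H)"
  shows "box_simplex (gen_mycielskian r H) (insert (Apex, odd (r - 1)) (lift (r - 1) ` S))"
proof -
  have lft: "box_simplex (gen_mycielskian r H) (lift (r - 1) ` S)"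
    using assms by (intro box_simplex_mono[OF lift_simplex[of H S "r - 1" r]]) auto
  have nbr: "\<exists>w. (u, w) \<in> parcs H" if "(u, \<sigma>) \<in> S" for u \<sigma>
    using assms(1) that by (auto simp: box_simplex_def)
  have top: "(Apex, y) \<in> parcs (gen_mycielskian r H) \<and> (y, Apex) \<in> parcs (gen_mycielskian r H)"
    if "(y, \<not> odd (r - 1)) \<in> lift (r - 1) ` S" for y
  proof -
    from that obtain u \<sigma> where u: "(u, \<sigma>) \<in> S" "y = Level (r - 1) u"
      by (auto simp: lift_def lift_level_def)
    then show ?thesis using nbr[OF u(1)] apex_adjacent[OF \<open>r > 0\<close> _ assms(4)] by blast
  qed
  obtain u \<sigma> where "(u, \<sigma>) \<in> S" using assms(2) by auto
  then have "\<exists>w. (Apex :: 'a mvertex, w) \<in> parcs (gen_mycielskian r H)"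
    using nbr apex_adjacent(1)[OF \<open>r > 0\<close> _ assms(4)] by blast
  then show ?thesis
    using lft top by (intro box_simplex_insert)
qed

text \<open>The new hemisphere consists of prisms from stage 0 up to stage \<open>r - 1\<close>,
  closed by a cone at the apex. Its boundary is the old sphere on level 0, which is invariant under
  the antipodal map.\<close>

lemma fan_chain_gen_mycielskian:
  assumes x: "fan_chain H n x" and "n > 0" "r > 0" "sym (parcs H)"
  shows "\<exists>y. fan_chain (gen_mycielskian r H) (Suc n) y"
proof -
  define z where "z = symmetrize x"
  define y where "y = concat (map (\<lambda>i. concat (map (prism (lift i) (lift (Suc i))) z)) [0..<r - 1])
    @ map (\<lambda>s. (Apex, odd (r - 1)) # map (lift (r - 1)) s) z"
  have z: "cycle z" using x by (simp add: fan_chain_def z_def)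
  have zs: "length s = n \<and> box_simplex H (set s)" if "s \<in> set z" for s
    using that x by (auto simp: fan_chain_def z_def symmetrize_def box_simplex_flip)
  have telescope: "(\<Sum>i\<leftarrow>[0..<k]. f i + f (Suc i)) = f 0 + f k" for f :: "nat \<Rightarrow> bit" and k
    by (induction k) (auto simp: ac_simps)
  have bdy: "(\<Sum>s\<leftarrow>y. \<Sum>t\<leftarrow>faces s. F t) = (\<Sum>s\<leftarrow>z. F (map (lift 0) s))" for F :: "_ \<Rightarrow> bit"
  proof -
    have "(\<Sum>s\<leftarrow>y. \<Sum>t\<leftarrow>faces s. F t)
      = (\<Sum>i\<leftarrow>[0..<r - 1]. (\<Sum>s\<leftarrow>z. F (map (lift i) s)) + (\<Sum>s\<leftarrow>z. F (map (lift (Suc i)) s)))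
        + (\<Sum>s\<leftarrow>z. F (map (lift (r - 1)) s))"
      unfolding y_def map_append sum_list_append sum_list_concat_map sum_list_map_map
        prism_cycle[OF z] cone_cycle[OF z] ..
    \<comment> \<open>Modulo 2 the intermediate stages cancel, and the last one cancels against the
      base of the cone.\<close>
    also have "\<dots> = (\<Sum>s\<leftarrow>z. F (map (lift 0) s))"
      unfolding telescope[of "\<lambda>i. \<Sum>s\<leftarrow>z. F (map (lift i) s)"] by (simp add: add.assoc)
    finally show ?thesis .
  qed
  have flip_lift: "flip \<circ> map_prod (Level 0) id = map_prod (Level 0) id \<circ> flip"
    by (auto simp: o_def map_prod_def)
  have flip_flip: "flip \<circ> flip = (id :: 'a mvertex \<times> bool \<Rightarrow> _)" by auto
  have simplices: "length s = Suc n \<and> box_simplex (gen_mycielskian r H) (set s)" if s: "s \<in> set y" for s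
  proof -
    consider i t where "i < r - 1" "t \<in> set z" "s \<in> set (prism (lift i) (lift (Suc i)) t)"
      | t where "t \<in> set z" "s = (Apex, odd (r - 1)) # map (lift (r - 1)) t"
      using s by (auto simp: y_def)
    then show ?thesis
    proof cases
      case 1
      then show ?thesis
        using zs[of t] length_prism[OF 1(3)] lift_simplex[of H "set t" "Suc i" r]
          box_simplex_mono[OF _ set_prism[OF 1(3)]] by simp
    next
      case 2
      then show ?thesis using zs[of t] cone_simplex[of H "set t" r] assms by auto
    qed
  qed
  have "cycle (symmetrize y)"
    unfolding cycle_def
  proof
    fix F :: "('a mvertex \<times> bool) list \<Rightarrow> bit"
    have "(\<Sum>s\<leftarrow>symmetrize y. \<Sum>t\<leftarrow>faces s. F t)
        = (\<Sum>s\<leftarrow>z. F (map (lift 0) s)) + (\<Sum>s\<leftarrow>z. F (map flip (map (lift 0) s)))"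
      unfolding sum_symmetrize faces_map sum_list_map_map bdy ..
    also have "\<dots> = 0"
      unfolding z_def sum_symmetrize lift_0 map_map flip_lift comp_assoc flip_flip
      by (simp add: add.commute)
    finally show "(\<Sum>s\<leftarrow>symmetrize y. \<Sum>t\<leftarrow>faces s. F t) = 0" .
  qed
  moreover have "(\<Sum>s\<leftarrow>y. of_bool (distinct_adj (sign_word c s))) = (1 :: bit)" for c :: "_ \<Rightarrow> nat"
  proof -
    let ?A = "\<lambda>t. of_bool (alternating_from True (sign_word c t)) :: bit"
    let ?d = "c \<circ> Level 0"
    have "(\<Sum>s\<leftarrow>y. of_bool (distinct_adj (sign_word c s))) = (\<Sum>s\<leftarrow>y. \<Sum>t\<leftarrow>faces s. ?A t)"
      using simplices by (intro arg_cong[where f = sum_list] map_cong refl sum_alternating_faces[symmetric])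
        force
    also have "\<dots> = (\<Sum>s\<leftarrow>z. ?A (map (lift 0) s))" by (rule bdy)
    \<comment> \<open>An old simplex and its antipode together count once if the simplex alternates,
      so the parity is that of \<open>x\<close> under the coloring of level 0.\<close>
    also have "\<dots> = (\<Sum>s\<leftarrow>x. of_bool (alternating_from True (sign_word ?d s))
        + of_bool (alternating_from True (map Not (sign_word ?d s))))"
      unfolding z_def sum_symmetrize lift_0 sign_word_map_prod by (simp add: sum_list_addf)
    also have "\<dots> = (\<Sum>s\<leftarrow>x. of_bool (distinct_adj (sign_word ?d s)))"
      using x \<open>n > 0\<close> unfolding fan_chain_def
      by (intro arg_cong[where f = sum_list] map_cong refl alternating_from_sum)
        auto
    also have "\<dots> = 1" using x by (simp add: fan_chain_def)
    finally show ?thesis .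
  qed
  ultimately show ?thesis using simplices unfolding fan_chain_def by blast
qed

text \<open>An edge gives the 4-cycle \<open>u+ w+ u- w-\<close>, and half of it is a path between
  antipodes. Only the second edge of the path has both signs, and it alternates in either color
  order.\<close>

lemma fan_chain_edge:
  assumes "(u, w) \<in> parcs H" "(w, u) \<in> parcs H"
  shows "fan_chain H 2 [[(u, True), (w, True)], [(w, True), (u, False)]]"
  using assms
  by (auto simp: fan_chain_def box_simplex_def cycle_def sum_symmetrize sign_word_def ac_simps)

section \<open>The upper bound\<close>

text \<open>Backtracking along an edge turns edges and walks of length 3 into walks of length 5.\<close>

definition wide_coloring :: "'v pair_pre_digraph \<Rightarrow> ('v \<Rightarrow> nat) \<Rightarrow> bool" where
  "wide_coloring H c \<longleftrightarrow> (\<forall>a b x y d e. (a, b) \<in> parcs H \<longrightarrow> (b, x) \<in> parcs H \<longrightarrow> (x, y) \<in> parcs H \<longrightarrow>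
    (y, d) \<in> parcs H \<longrightarrow> (d, e) \<in> parcs H \<longrightarrow> c a \<noteq> c e)"

lemma wide_coloringD:
  "wide_coloring H c \<Longrightarrow> (a, b) \<in> parcs H \<Longrightarrow> (b, x) \<in> parcs H \<Longrightarrow> (x, y) \<in> parcs H \<Longrightarrow>
    (y, d) \<in> parcs H \<Longrightarrow> (d, e) \<in> parcs H \<Longrightarrow> c a \<noteq> c e"
  unfolding wide_coloring_def by blast

lemma wide_coloring_local_colors:
  fixes c :: "'v \<Rightarrow> nat"
  assumes H: "sym (parcs H)" and wide: "wide_coloring H c" and bound: "\<And>v. c v < t"
  shows "\<exists>c' :: 'v \<Rightarrow> nat. proper_coloring H c' \<and> (\<forall>v. card (c' ` neighbourhood H v) \<le> t div 2 + 1)"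
proof -
  define T where "T = {v. t < 2 * card (c ` neighbourhood H v)}"
  define c' where "c' x = (if \<exists>v\<in>T. (x, v) \<in> parcs H then t else c x)" for x
  have sym: "(v, u) \<in> parcs H" if "(u, v) \<in> parcs H" for u v using H that by (auto dest: symD)
  have sub: "c ` neighbourhood H v \<subseteq> {..<t}" for v using bound by auto
  then have fin: "finite (c ` neighbourhood H v)" for v using finite_subset by blast
  have common: "\<exists>a b. (a, v) \<in> parcs H \<and> (w, b) \<in> parcs H \<and> c a = c b" if "v \<in> T" "w \<in> T" for v w
  proof -
    let ?A = "c ` neighbourhood H v" and ?B = "c ` neighbourhood H w"
    have "card (?A \<union> ?B) \<le> t" using card_mono[of "{..<t}" "?A \<union> ?B"] sub[of v] sub[of w] by auto
    then have "?A \<inter> ?B \<noteq> {}"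
      using card_Un_disjoint[OF fin[of v] fin[of w]] that by (auto simp: T_def)
    then show ?thesis using sym by (fastforce simp: neighbourhood_def)
  qed
  have "c' x \<noteq> c' y" if xy: "(x, y) \<in> parcs H" for x y
  proof -
    \<comment> \<open>The walk \<open>a\<close>, \<open>v\<close>, \<open>x\<close>,
      \<open>y\<close>, \<open>w\<close>, \<open>b\<close> has length 5 and ends of equal color, so
      adjacent \<open>x\<close> and \<open>y\<close> are never both recolored.\<close>
    have "False" if "v \<in> T" "(x, v) \<in> parcs H" "w \<in> T" "(y, w) \<in> parcs H" for v w
      using common[OF that(1,3)] wide_coloringD[OF wide _ sym[OF that(2)] xy that(4)] by blast
    moreover have "c x \<noteq> c y" using wide_coloringD[OF wide] xy sym by blast
    ultimately show ?thesis using bound[of x] bound[of y] unfolding c'_def by auto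
  qed
  then have "proper_coloring H c'" unfolding proper_coloring_def by auto
  moreover have "card (c' ` neighbourhood H v) \<le> t div 2 + 1" for v
  proof (cases "v \<in> T")
    case True
    then have "c' ` neighbourhood H v \<subseteq> {t}"
      using sym unfolding c'_def neighbourhood_def by auto
    then have "card (c' ` neighbourhood H v) \<le> card {t}" by (intro card_mono) auto
    then show ?thesis by simp
  next
    case False
    have "card (c' ` neighbourhood H v) \<le> card (insert t (c ` neighbourhood H v))"
      using fin by (intro card_mono) (auto simp: c'_def)
    also have "\<dots> \<le> t div 2 + 1" using False fin[of v] by (auto simp: T_def card_insert_if)
    finally show ?thesis .
  qed
  ultimately show ?thesis by blast
qed

text \<open>The default is meant for \<open>Apex\<close>; no vertex of
  \<open>gen_mycielskian r H\<close> is of the form \<open>Base\<close>.\<close>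

fun height :: "nat \<Rightarrow> 'a mvertex \<Rightarrow> nat" where
  "height r (Level a u) = a"
| "height r _ = r"

fun projection :: "'a mvertex \<Rightarrow> 'a mvertex" where
  "projection (Level a u) = u"
| "projection v = v"

text \<open>Heights change parity along every arc except inside level 0, and a walk avoiding the
  apex projects to a walk in \<open>H\<close>.\<close>

lemma gen_mycielskian_arcD:
  assumes "(x, y) \<in> parcs (gen_mycielskian r H)"
  shows "height r x = 0 \<and> height r y = 0 \<or> height r y = Suc (height r x) \<or> height r x = Suc (height r y)"
    and "height r x \<noteq> r \<Longrightarrow> height r y \<noteq> r \<Longrightarrow> (projection x, projection y) \<in> parcs H"
  using assms unfolding parcs_gen_mycielskian looped_path_arc
  by (auto simp: node_def split: if_splits)

text \<open>
  The new color sits at the apex and at even distance below it, except on the three lowest levels.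
  An odd closed pattern of levels has to use the loop, while an old color next to the apex is at
  odd distance from it: both kinds of conflict need a walk longer than 5 because \<open>r \<ge> 7\<close>.
\<close>

lemma wide_coloring_gen_mycielskian:
  assumes wide: "wide_coloring H c" and bound: "\<And>v. c v < t" and "r \<ge> 7"
  shows "\<exists>c'. wide_coloring (gen_mycielskian r H) c' \<and> (\<forall>v. c' v < Suc t)"
proof -
  define new where "new x \<longleftrightarrow> height r x \<ge> 3 \<and> even (r + height r x)" for x :: "'a mvertex"
  define c' where "c' x = (if new x then t else c (projection x))" for x
  have "c' x0 \<noteq> c' x5"
    if w: "(x0, x1) \<in> parcs (gen_mycielskian r H)" "(x1, x2) \<in> parcs (gen_mycielskian r H)"
      "(x2, x3) \<in> parcs (gen_mycielskian r H)" "(x3, x4) \<in> parcs (gen_mycielskian r H)"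
      "(x4, x5) \<in> parcs (gen_mycielskian r H)" for x0 x1 x2 x3 x4 x5
  proof
    assume eq: "c' x0 = c' x5"
    note h = w[THEN gen_mycielskian_arcD(1)]
    have close: "a \<le> Suc b \<and> b \<le> Suc a" if "a = 0 \<and> b = 0 \<or> b = Suc a \<or> a = Suc b" for a b :: nat
      using that by auto
    note near = h[THEN close, THEN conjunct1] h[THEN close, THEN conjunct2]
    have parity: "odd (height r x0 + height r x5)"
      if "height r x0 > 0" "height r x1 > 0" "height r x2 > 0"
        "height r x3 > 0" "height r x4 > 0" "height r x5 > 0"
    proof -
      have step: "even b \<longleftrightarrow> odd a"
        if "a = 0 \<and> b = 0 \<or> b = Suc a \<or> a = Suc b" "a > 0" for a b :: nat
        using that by auto
      show ?thesis using that step[OF h(1)] step[OF h(2)] step[OF h(3)] step[OF h(4)] step[OF h(5)]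
        by auto
    qed
    consider "new x0" "new x5" | "\<not> new x0" "\<not> new x5"
      using eq bound unfolding c'_def by (metis nat_neq_iff)
    then show False
    proof cases
      case 1
      \<comment> \<open>With both ends at height 3 or more, a walk of length 5 cannot reach level 0,
        so \<open>parity\<close> applies.\<close>
      then have "height r x0 \<ge> 3" "height r x5 \<ge> 3" by (auto simp: new_def)
      then have "height r x1 \<ge> 2" "height r x2 \<ge> 1" "height r x4 \<ge> 2" "height r x3 \<ge> 1"
        using near by linarith+
      then have "odd (height r x0 + height r x5)"
        using parity \<open>height r x0 \<ge> 3\<close> \<open>height r x5 \<ge> 3\<close> by auto
      then show False using 1 by (auto simp: new_def)
    next
      case 2
      then have ends: "height r x0 \<noteq> r" "height r x5 \<noteq> r" using \<open>r \<ge> 7\<close> by (auto simp: new_def)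
      have "height r x1 = r \<or> height r x2 = r \<or> height r x3 = r \<or> height r x4 = r"
      proof (rule ccontr)
        assume "\<not> ?thesis"
        then have "c (projection x0) \<noteq> c (projection x5)"
          using ends w[THEN gen_mycielskian_arcD(2)] by (intro wide_coloringD[OF wide]) auto
        then show False using eq 2 by (simp add: c'_def)
      qed
      \<comment> \<open>The walk meets the apex at an inner vertex, so all heights are at least
        \<open>r - 4\<close>. Above level 2, ends with old colors have heights of equal
        parity.\<close>
      then have "height r x0 \<ge> 3" "height r x1 \<ge> 3" "height r x2 \<ge> 3"
          "height r x3 \<ge> 3" "height r x4 \<ge> 3" "height r x5 \<ge> 3"
        using near \<open>r \<ge> 7\<close> by (elim disjE; linarith)+
      then show False using parity 2 by (auto simp: new_def)
    qed
  qed
  then have "wide_coloring (gen_mycielskian r H) c'" unfolding wide_coloring_def by blast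
  moreover have "c' v < Suc t" for v using bound by (simp add: c'_def less_SucI)
  ultimately show ?thesis by blast
qed

section \<open>Iteration\<close>

text \<open>Each round adds one vertex to the simplices and one color to the wide coloring.\<close>

lemma fold_gen_mycielskian:
  assumes "\<forall>r\<in>set rs. r \<ge> 7" "finite_graph H" "fan_chain H n x" "n > 0"
    "wide_coloring H c" "\<And>v. c v < t"
  shows "finite_graph (fold gen_mycielskian rs H) \<and> (\<exists>x. fan_chain (fold gen_mycielskian rs H) (n + length rs) x) \<and>
    (\<exists>c. wide_coloring (fold gen_mycielskian rs H) c \<and> (\<forall>v. c v < t + length rs))"
  using assms
proof (induction rs arbitrary: H n x c t)
  case Nil
  then show ?case by auto
next
  case (Cons r rs)
  obtain y where y: "fan_chain (gen_mycielskian r H) (Suc n) y"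
    using fan_chain_gen_mycielskian[of H n x r] Cons.prems by (auto simp: finite_graph_def)
  obtain c' where c': "wide_coloring (gen_mycielskian r H) c'" "\<And>v. c' v < Suc t"
    using wide_coloring_gen_mycielskian[of H c t r] Cons.prems by auto
  from Cons.IH[of "gen_mycielskian r H" "Suc n" y c' "Suc t", OF _ _ y _ c'] Cons.prems
  show ?case by (simp add: finite_graph_gen_mycielskian)
qed

lemma iterated_mycielskian_K2:
  assumes "K\<^bsub>2\<^esub> (with_proj G)" "\<forall>r\<in>set rs. r \<ge> 7"
  shows "finite_graph (iterated_mycielskian rs G)"
    and "\<exists>x. fan_chain (iterated_mycielskian rs G) (length rs + 2) x"
    and "\<exists>c. wide_coloring (iterated_mycielskian rs G) c \<and> (\<forall>v. c v < length rs + 2)"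
proof -
  let ?H = "image_graph Base G"
  have G: "card (pverts G) = 2" "parcs G = {(u, v). (u, v) \<in> pverts G \<times> pverts G \<and> u \<noteq> v}"
    using assms(1) unfolding complete_digraph_pair_def by auto
  then obtain u w where uw: "pverts G = {u, w}" "u \<noteq> w" by (meson card_2_iff)
  have H: "pverts ?H = {Base u, Base w}" "parcs ?H = {(Base u, Base w), (Base w, Base u)}"
    using uw G(2) by (auto simp: image_graph_def)
  have 1: "finite_graph ?H" using H by (auto simp: finite_graph_def sym_def)
  have 2: "fan_chain ?H 2 [[(Base u, True), (Base w, True)], [(Base w, True), (Base u, False)]]"
    using H by (intro fan_chain_edge) auto
  \<comment> \<open>A walk of length 5 on a single edge ends at the other vertex.\<close>
  have 3: "wide_coloring ?H (\<lambda>v. if v = Base u then 0 else 1)"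
    using H uw by (auto simp: wide_coloring_def)
  show "finite_graph (iterated_mycielskian rs G)"
    and "\<exists>x. fan_chain (iterated_mycielskian rs G) (length rs + 2) x"
    and "\<exists>c. wide_coloring (iterated_mycielskian rs G) c \<and> (\<forall>v. c v < length rs + 2)"
    using fold_gen_mycielskian[OF assms(2) 1 2 _ 3, of 2]
    by (auto simp: iterated_mycielskian_def add.commute)
qed

theorem theorem2p5:
  fixes d :: nat and r :: "nat list" and G :: "'a pair_pre_digraph"
  assumes "odd d"
    and "length r = d"
    and "\<And>i. i < d \<Longrightarrow> r ! i \<ge> 7"
    and "K\<^bsub>2\<^esub> (with_proj G)"
  shows "int (local_chromatic_number (iterated_mycielskian r G)) = \<lceil>real d / 2\<rceil> + 2"
proof -
  let ?M = "iterated_mycielskian r G"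
  let ?max = "\<lambda>c :: 'a mvertex \<Rightarrow> nat. MAX v\<in>pverts ?M. card (c ` neighbourhood ?M v)"
  obtain k where k: "d = 2 * k + 1" using assms(1) by (elim oddE)
  have "\<forall>a\<in>set r. a \<ge> 7" using assms(2,3) by (auto simp: in_set_conv_nth)
  note M = iterated_mycielskian_K2[OF assms(4) this]
  have fin: "finite (pverts ?M)" "pverts ?M \<noteq> {}" "sym (parcs ?M)"
    using M(1) by (auto simp: finite_graph_def)
  \<comment> \<open>Here \<open>m = k + 1\<close>, because
    \<open>d + 2 = 2 * (k + 1) + 1\<close>.\<close>
  obtain x where x: "fan_chain ?M (2 * (k + 1) + 1) x"
    using M(2) assms(2) k by auto
  have lower: "k + 2 \<le> ?max c" if c: "proper_coloring ?M c" for c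
  proof -
    obtain v where "v \<in> pverts ?M" "k + 2 \<le> card (c ` neighbourhood ?M v)"
      using local_colors_lower_bound[OF M(1) x _ c] by auto
    then show ?thesis using fin by (auto simp: Max_ge_iff)
  qed
  have "length r + 2 = 2 * k + 3" using assms(2) k by simp
  then obtain c where c: "wide_coloring ?M c" "\<And>v. c v < 2 * k + 3"
    using M(3) by metis
  have "(2 * k + 3) div 2 + 1 = k + 2" by simp
  then obtain c' :: "'a mvertex \<Rightarrow> nat"
    where c': "proper_coloring ?M c'" "\<forall>v. card (c' ` neighbourhood ?M v) \<le> k + 2"
    using wide_coloring_local_colors[OF fin(3) c] by auto
  have "?max c' \<le> k + 2" using c'(2) fin by (simp add: Max_le_iff)
  \<comment> \<open>The minimum is attained at \<open>c'\<close>; the 1 added in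
    \<open>local_chromatic_number\<close> then gives \<open>k + 3\<close>.\<close>
  then have "(INF c\<in>{c. proper_coloring ?M c}. ?max c) = k + 2"
    using lower c'(1) by (intro cInf_eq_minimum) (auto intro!: image_eqI[of _ _ c'] antisym)
  moreover have "\<lceil>real d / 2\<rceil> = int k + 1"
    using k by (intro ceiling_unique) auto
  ultimately show ?thesis by (simp add: local_chromatic_number_def)
qed

end
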